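(* Let $\{|0\rangle,|1\rangle\}$ be an orthonormal basis of $\mathcal{H}_2$, $|v_\pm\rangle=\frac12|0\rangle\pm\frac{\sqrt3}{2}|1\rangle$, and let $\mathcal{M}$ be the three-outcome qubit measurement $M_1=\frac23|0\rangle\langle0|$, $M_2=\frac23|v_+\rangle\langle v_+|$, $M_3=\frac23|v_-\rangle\langle v_-|$. For $\theta\in\mathbb{R}$ let $\mathcal{N}_\theta$ be the measurement with $N_j=R_\theta M_jR_\theta^\dagger$, where $R_\theta=|0\rangle\langle0|+e^{i\theta}|1\rangle\langle1|$. Consider unambiguous discrimination of $\mathcal{M}$ and $\mathcal{N}_\theta$ with equal prior probabilities $1/2$. (i) For every $q\in[0,1]$, the minimal failure probability over all unambiguous tests whose normalization $\rho$ satisfies $\langle0|\rho|0\rangle=q$ is $$\frac{2q+\sqrt{q^2+9(1-q)^2+6q(1-q)\cos\theta}}{3}.$$ (ii) The minimal failure probability over all unambiguous tests is $$p_f=\frac13\left(1+\sqrt3\,\Big|\cos\frac{\theta}{2}\Big|+\frac{4-2\sqrt3\,|\cos\frac{\theta}{2}|}{5-3\cos\theta}\right).$$ (iii) If $\theta\notin2\pi\mathbb{Z}$, this minimum is strictly smaller than the minimal failure probability attainable by unambiguous tests using a maximally entangled probe state (i.e. tests with normalization $\rho=\frac12I$).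
   Context: $\mathcal{H}_2$ is the two-dimensional complex Hilbert space. A (single-shot, general ancilla-assisted) test $\mathcal{T}$ with conclusions $c\in\{\mathcal{M},\mathcal{N}_\theta,f\}$ ($f$ = inconclusive) is a family of positive semidefinite operators $H^{(c)}_j$ on $\mathcal{H}_2$, $j=1,2,3$, with $\sum_c H^{(c)}_j=\rho$ for every $j$, where $\rho\ge0$, $\mathrm{tr}[\rho]=1$, independent of $j$, is called the normalization of the test. The probability of conclusion $c$ when the tested measurement has POVM $\{A_j\}$ is $p(c|\mathcal{A},\mathcal{T})=\sum_j \mathrm{tr}[H^{(c)}_jA_j]$. With equal priors, $p_e=\frac12p(\mathcal N_\theta|\mathcal M,\mathcal T)+\frac12p(\mathcal M|\mathcal N_\theta,\mathcal T)$ and $p_f=\frac12p(f|\mathcal M,\mathcal T)+\frac12p(f|\mathcal N_\theta,\mathcal T)$. A test is unambiguous if $p_e=0$. Tests with $\rho=\frac12I$ correspond to experimental protocols whose bipartite probe state is maximally entangled. *)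

theory Defs
  imports "HOL-Analysis.Analysis"
begin

text \<open>The Hilbert space is \<open>complex^2\<close>, with the complex inner product below (conjugate-linear
  in the first argument); the inner product of the library on this type is its real part.\<close>

definition cinner :: "complex^2 \<Rightarrow> complex^2 \<Rightarrow> complex" where
  "cinner u v = (\<Sum>i\<in>UNIV. cnj (u $ i) * v $ i)"

definition dagger :: "complex^2^2 \<Rightarrow> complex^2^2" where
  "dagger A = (\<chi> i j. cnj (A $ j $ i))"

definition ketbra :: "complex^2 \<Rightarrow> complex^2 \<Rightarrow> complex^2^2" where
  "ketbra u v = (\<chi> i j. u $ i * cnj (v $ j))"

definition psd :: "complex^2^2 \<Rightarrow> bool" where
  "psd A \<longleftrightarrow> dagger A = A \<and> (\<forall>v. 0 \<le> Re (cinner v (A *v v)))"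

text \<open>Two orthonormal vectors of \<open>complex^2\<close> span it, by dimension.\<close>

definition orthonormal_basis :: "complex^2 \<Rightarrow> complex^2 \<Rightarrow> bool" where
  "orthonormal_basis e0 e1 \<longleftrightarrow> cinner e0 e0 = 1 \<and> cinner e1 e1 = 1 \<and> cinner e0 e1 = 0"

text \<open>Outcomes \<open>1, 2, 3\<close> are the three elements of the numeral type \<open>3\<close> (in which \<open>3 = 0\<close>).\<close>

type_synonym measurement = "3 \<Rightarrow> complex^2^2"

text \<open>\<open>First\<close> and \<open>Second\<close> are the conclusions that the tested measurement is \<open>A\<close>, respectively \<open>B\<close>,
  when discriminating \<open>A\<close> from \<open>B\<close>.\<close>

datatype conclusion = First | Second | Inconclusive

type_synonym test = "conclusion \<Rightarrow> 3 \<Rightarrow> complex^2^2"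

definition test_with_normalization :: "complex^2^2 \<Rightarrow> test \<Rightarrow> bool" where
  "test_with_normalization \<rho> H \<longleftrightarrow>
     psd \<rho> \<and> trace \<rho> = 1 \<and> (\<forall>c j. psd (H c j)) \<and>
     (\<forall>j. H First j + H Second j + H Inconclusive j = \<rho>)"

text \<open>For positive semidefinite arguments the sum of traces is already real, so \<open>Re\<close> only
  changes the type.\<close>

definition concl_prob :: "conclusion \<Rightarrow> measurement \<Rightarrow> test \<Rightarrow> real" where
  "concl_prob c A H = Re (\<Sum>j\<in>UNIV. trace (H c j ** A j))"

definition error_prob :: "measurement \<Rightarrow> measurement \<Rightarrow> test \<Rightarrow> real" where
  "error_prob A B H = 1/2 * concl_prob Second A H + 1/2 * concl_prob First B H"

definition failure_prob :: "measurement \<Rightarrow> measurement \<Rightarrow> test \<Rightarrow> real" where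
  "failure_prob A B H = 1/2 * concl_prob Inconclusive A H + 1/2 * concl_prob Inconclusive B H"

definition unambiguous :: "measurement \<Rightarrow> measurement \<Rightarrow> test \<Rightarrow> bool" where
  "unambiguous A B H \<longleftrightarrow> error_prob A B H = 0"

text \<open>Failure probabilities of the unambiguous tests whose normalization satisfies \<open>P\<close>.\<close>

definition failure_probs ::
    "measurement \<Rightarrow> measurement \<Rightarrow> (complex^2^2 \<Rightarrow> bool) \<Rightarrow> real set" where
  "failure_probs A B P =
     {failure_prob A B H | \<rho> H. test_with_normalization \<rho> H \<and> unambiguous A B H \<and> P \<rho>}"

definition is_minimum :: "real set \<Rightarrow> real \<Rightarrow> bool" where
  "is_minimum S m \<longleftrightarrow> m \<in> S \<and> (\<forall>x\<in>S. m \<le> x)"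

definition v_plus :: "complex^2 \<Rightarrow> complex^2 \<Rightarrow> complex^2" where
  "v_plus e0 e1 = (1/2) *\<^sub>R e0 + (sqrt 3 / 2) *\<^sub>R e1"

definition v_minus :: "complex^2 \<Rightarrow> complex^2 \<Rightarrow> complex^2" where
  "v_minus e0 e1 = (1/2) *\<^sub>R e0 - (sqrt 3 / 2) *\<^sub>R e1"

definition meas_M :: "complex^2 \<Rightarrow> complex^2 \<Rightarrow> measurement" where
  "meas_M e0 e1 j =
     (if j = 1 then (2/3) *\<^sub>R ketbra e0 e0
      else if j = 2 then (2/3) *\<^sub>R ketbra (v_plus e0 e1) (v_plus e0 e1)
      else (2/3) *\<^sub>R ketbra (v_minus e0 e1) (v_minus e0 e1))"

definition rot :: "complex^2 \<Rightarrow> complex^2 \<Rightarrow> real \<Rightarrow> complex^2^2" where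
  "rot e0 e1 \<theta> = ketbra e0 e0 + ketbra (cis \<theta> *s e1) e1"

definition meas_N :: "complex^2 \<Rightarrow> complex^2 \<Rightarrow> real \<Rightarrow> measurement" where
  "meas_N e0 e1 \<theta> j = rot e0 e1 \<theta> ** meas_M e0 e1 j ** dagger (rot e0 e1 \<theta>)"

end

theory Submission imports Defs begin

text \<open>Write \<open>M\<^sub>j = 2/3 |\<psi>\<^sub>j\<rangle>\<langle>\<psi>\<^sub>j|\<close> and \<open>N\<^sub>j = 2/3 |\<phi>\<^sub>j\<rangle>\<langle>\<phi>\<^sub>j|\<close>. By Cauchy--Schwarz for the failure operators,
  an unambiguous test with normalization \<open>\<rho>\<close> fails with probability at least
  \<open>2/3 \<Sum>\<^sub>j |\<langle>\<psi>\<^sub>j|\<rho>|\<phi>\<^sub>j\<rangle>|\<close>. The off-diagonal entries of \<open>\<rho>\<close> contribute with opposite signs to the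
  terms \<open>j = 2\<close> and \<open>j = 3\<close>, so by the triangle inequality they only increase the sum, and what remains is
  the formula of part (i). A diagonal \<open>\<rho>\<close> attains it, with conclusive operators proportional to the
  projections orthogonal to \<open>\<phi>\<^sub>j\<close> and \<open>\<psi>\<^sub>j\<close>. With \<open>k = \<surd>3 |cos (\<theta>/2)|\<close> and
  \<open>L = 1 + k + 1/(2 + k)\<close>, the radicand in (i) exceeds \<open>(L - 2q)\<^sup>2\<close> by
  \<open>(12 - 4k\<^sup>2) (q - q\<^sub>0)\<^sup>2\<close>, where \<open>q\<^sub>0 = (3 + k)/(4 + 2k) > 1/2\<close>; this gives (ii) and (iii).\<close>

section \<open>Sesquilinear forms of positive semidefinite operators\<close>

definition form :: "complex^2^2 \<Rightarrow> complex^2 \<Rightarrow> complex^2 \<Rightarrow> complex" where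
  "form A u v = cinner u (A *v v)"

lemma cinner_2: "cinner u v = cnj (u $ 1) * v $ 1 + cnj (u $ 2) * v $ 2"
  by (simp add: cinner_def sum_2)

lemma form_2: "form A u v = cnj (u$1) * A$1$1 * v$1 + cnj (u$1) * A$1$2 * v$2
    + cnj (u$2) * A$2$1 * v$1 + cnj (u$2) * A$2$2 * v$2"
  by (simp add: form_def cinner_2 matrix_vector_mult_def sum_2 algebra_simps)

lemma scaleR_entry: "(r *\<^sub>R (A :: complex^2^2)) $ i $ j = of_real r * A $ i $ j"
  unfolding vector_scaleR_component by (rule scaleR_conv_of_real)

lemma form_add: "form (A + B) u v = form A u v + form B u v"
  and form_diff: "form (A - B) u v = form A u v - form B u v"
  and form_scaleR: "form (r *\<^sub>R A) u v = r * form A u v"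
  and form_zero: "form 0 u v = 0"
  and form_add_left: "form A (u + u') v = form A u v + form A u' v"
  and form_add_right: "form A u (v + v') = form A u v + form A u v'"
  and form_smult_left: "form A (a *s u) v = cnj a * form A u v"
  and form_smult_right: "form A u (a *s v) = a * form A u v"
  by (simp_all add: form_2 algebra_simps scaleR_entry del: vector_scaleR_component)

lemma form_ketbra: "form (ketbra a b) u v = cinner u a * cinner b v"
  by (simp add: form_2 cinner_2 ketbra_def algebra_simps)

lemma trace_mult_ketbra: "trace (A ** ketbra u v) = form A v u"
  by (simp add: form_2 trace_def matrix_matrix_mult_def ketbra_def sum_2 algebra_simps)

lemma trace_mult_scaleR_ketbra: "trace (A ** (r *\<^sub>R ketbra u v)) = r * form A v u"
  by (simp add: form_2 trace_def matrix_matrix_mult_def ketbra_def sum_2 scaleR_entry algebra_simps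
      del: vector_scaleR_component)

lemma cnj_cinner: "cnj (cinner u v) = cinner v u"
  by (simp add: cinner_2 algebra_simps)

lemma form_hermitian:
  assumes "dagger A = A"
  shows "form A v u = cnj (form A u v)"
proof -
  have *: "A $ i $ j = cnj (A $ j $ i)" for i j
    using assms by (metis (no_types, lifting) dagger_def vec_lambda_beta)
  show ?thesis
    using *[of 1 1] *[of 1 2] *[of 2 2] by (simp add: form_2 algebra_simps)
qed

lemma psd_iff_form: "psd A \<longleftrightarrow> dagger A = A \<and> (\<forall>v. 0 \<le> Re (form A v v))"
  by (simp add: psd_def form_def)

lemma psd_zero: "psd 0"
  by (simp add: psd_iff_form form_zero dagger_def vec_eq_iff)

lemma psd_add: "psd A \<Longrightarrow> psd B \<Longrightarrow> psd (A + B)"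
  by (simp add: psd_iff_form form_add dagger_def vec_eq_iff)

lemma form_ketbra_self: "form (ketbra a a) v v = of_real ((cmod (cinner a v))\<^sup>2)"
  by (metis cnj_cinner complex_norm_square form_ketbra mult.commute)

lemma psd_scaleR_ketbra:
  assumes "r \<ge> 0"
  shows "psd (r *\<^sub>R ketbra u u)"
proof -
  have "dagger (r *\<^sub>R ketbra u u) = r *\<^sub>R ketbra u u"
    by (simp add: dagger_def ketbra_def vec_eq_iff)
  then show ?thesis
    using assms
    by (simp add: psd_iff_form form_scaleR form_ketbra_self del: of_real_power)
qed

lemma psd_form_real:
  assumes "psd A"
  shows "form A u u = of_real (Re (form A u u))"
  using form_hermitian[of A u u] assms
  by (simp add: psd_iff_form complex_eq_iff)

text \<open>Cauchy-Schwarz with the geometric mean weakened to the arithmetic mean: it is positivity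
  at \<open>u - w v\<close>, where the phase \<open>w\<close> turns the cross term into its
  modulus.\<close>

lemma psd_form_norm_le:
  assumes "psd A"
  shows "2 * cmod (form A u v) \<le> Re (form A u u) + Re (form A v v)"
proof -
  define z where "z = form A u v"
  obtain w where w: "cmod w = 1" "w * z = of_real (cmod z)"
  proof (cases "z = 0")
    case True
    then show ?thesis using that[of 1] by simp
  next
    case False
    then show ?thesis
      using that[of "cnj z / cmod z"]
      by (simp add: norm_divide complex_norm_square mult.commute power2_eq_square divide_simps
          flip: of_real_mult)
         (metis complex_norm_square mult.commute power2_eq_square)
  qed
  have *: "form A (u + a *s v) (u + a *s v)
      = form A u u + a * form A u v + cnj (a * form A u v) + (a * cnj a) * form A v v" for a
    using form_hermitian[of A u v] assms
    by (simp add: psd_iff_form form_add_left form_add_right form_smult_left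
        form_smult_right algebra_simps)
  moreover have "0 \<le> Re (form A (u + (- w) *s v) (u + (- w) *s v))"
    using assms unfolding psd_iff_form by blast
  moreover have "w * cnj w = 1"
    using w(1) by (simp flip: complex_norm_square)
  ultimately show ?thesis
    using w(2) *[of "- w"] by (simp add: z_def)
qed

text \<open>Scaling \<open>u\<close> up keeps its diagonal value at zero but magnifies the cross
  term, while the bound \<open>Re (form A v v)\<close> stays fixed.\<close>

lemma psd_form_zero:
  assumes "psd A" "Re (form A u u) = 0"
  shows "form A u v = 0" and "form A v u = 0"
proof -
  have bound: "2 * r * cmod (form A u v) \<le> Re (form A v v)" if "r \<ge> 0" for r :: real
    using psd_form_norm_le[OF assms(1), of "of_real r *s u" v] assms(2) that
    by (simp add: form_smult_left form_smult_right norm_mult)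
  show "form A u v = 0"
  proof (rule ccontr)
    assume "form A u v \<noteq> 0"
    then have "cmod (form A u v) > 0" by simp
    moreover have "Re (form A v v) \<ge> 0" using assms(1) by (simp add: psd_iff_form)
    ultimately show False
      \<comment> \<open>For this scale the bound reads
        \<open>2 * (Re (form A v v) + 1) \<le> Re (form A v v)\<close>.\<close>
      using bound[of "(Re (form A v v) + 1) / cmod (form A u v)"]
      by (simp add: divide_simps)
  qed
  then show "form A v u = 0"
    using form_hermitian[of A u v] assms(1) by (simp add: psd_iff_form)
qed

section \<open>Discrimination of rank-one measurements\<close>

lemma concl_prob_rank_one:
  assumes "\<And>j. A j = r *\<^sub>R ketbra (\<psi> j) (\<psi> j)"
  shows "concl_prob c A H = r * (\<Sum>j\<in>UNIV. Re (form (H c j) (\<psi> j) (\<psi> j)))"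
proof -
  have "trace (H c j ** A j) = r * form (H c j) (\<psi> j) (\<psi> j)" for j
    by (simp add: assms trace_mult_scaleR_ketbra)
  then show ?thesis
    by (simp add: concl_prob_def sum_distrib_left)
qed

text \<open>The error probability is \<open>r / 2\<close> times a sum of nonnegative expectations,
  so it vanishes only termwise.\<close>

lemma unambiguous_rank_one:
  assumes "\<And>j. A j = r *\<^sub>R ketbra (\<psi> j) (\<psi> j)" "\<And>j. B j = r *\<^sub>R ketbra (\<phi> j) (\<phi> j)"
    and "r > 0" "\<And>c j. psd (H c j)"
  shows "unambiguous A B H \<longleftrightarrow>
    (\<forall>j. Re (form (H Second j) (\<psi> j) (\<psi> j)) = 0 \<and> Re (form (H First j) (\<phi> j) (\<phi> j)) = 0)"
proof -
  define f where "f = (\<lambda>j. Re (form (H Second j) (\<psi> j) (\<psi> j)) + Re (form (H First j) (\<phi> j) (\<phi> j)))"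
  have nn: "0 \<le> Re (form (H c j) v v)" for c j v
    using assms(4) by (simp add: psd_iff_form)
  have "error_prob A B H = r / 2 * sum f UNIV"
    by (simp add: error_prob_def concl_prob_rank_one[OF assms(1)] concl_prob_rank_one[OF assms(2)]
        f_def sum.distrib distrib_left)
  then have "unambiguous A B H \<longleftrightarrow> sum f UNIV = 0"
    unfolding unambiguous_def using assms(3)
    by (metis divide_pos_pos less_numeral_extra(3) mult_eq_0_iff zero_less_numeral)
  also have "\<dots> \<longleftrightarrow> (\<forall>j. f j = 0)"
    by (subst sum_nonneg_eq_0_iff) (auto simp: f_def nn)
  finally show ?thesis
    by (simp add: f_def add_nonneg_eq_0_iff nn)
qed

text \<open>Unambiguity forces \<open>\<langle>\<psi>\<^sub>j| H\<^sub>j = 0\<close> for the second conclusion and \<open>H\<^sub>j |\<phi>\<^sub>j\<rangle> = 0\<close> for the first,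
  so the failure operator has the same matrix element \<open>\<langle>\<psi>\<^sub>j|_|\<phi>\<^sub>j\<rangle>\<close> as the normalization.\<close>

lemma failure_prob_ge_rank_one:
  assumes A: "\<And>j. A j = r *\<^sub>R ketbra (\<psi> j) (\<psi> j)" and B: "\<And>j. B j = r *\<^sub>R ketbra (\<phi> j) (\<phi> j)"
    and "r > 0" and test: "test_with_normalization \<rho> H" and unamb: "unambiguous A B H"
  shows "r * (\<Sum>j\<in>UNIV. cmod (form \<rho> (\<psi> j) (\<phi> j))) \<le> failure_prob A B H"
proof -
  have psd: "psd (H c j)" for c j
    using test by (simp add: test_with_normalization_def)
  have le: "2 * cmod (form \<rho> (\<psi> j) (\<phi> j)) \<le> Re (form (H Inconclusive j) (\<psi> j) (\<psi> j))
      + Re (form (H Inconclusive j) (\<phi> j) (\<phi> j))" for j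
  proof -
    have "form (H Second j) (\<psi> j) (\<phi> j) = 0" "form (H First j) (\<psi> j) (\<phi> j) = 0"
      using unamb psd_form_zero[OF psd]
      unfolding unambiguous_rank_one[OF A B \<open>r > 0\<close> psd] by blast+
    moreover have "\<rho> = H First j + H Second j + H Inconclusive j"
      using test by (simp add: test_with_normalization_def)
    ultimately have "form \<rho> (\<psi> j) (\<phi> j) = form (H Inconclusive j) (\<psi> j) (\<phi> j)"
      by (simp add: form_add)
    then show ?thesis
      using psd_form_norm_le[OF psd] by simp
  qed
  have "failure_prob A B H = r / 2 * (\<Sum>j\<in>UNIV. Re (form (H Inconclusive j) (\<psi> j) (\<psi> j))
      + Re (form (H Inconclusive j) (\<phi> j) (\<phi> j)))"
    by (simp add: failure_prob_def concl_prob_rank_one[OF A] concl_prob_rank_one[OF B]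
        sum.distrib algebra_simps)
  also have "\<dots> \<ge> r / 2 * (\<Sum>j\<in>UNIV. 2 * cmod (form \<rho> (\<psi> j) (\<phi> j)))"
    using le \<open>r > 0\<close> by (intro mult_left_mono sum_mono) auto
  finally show ?thesis
    by (simp add: sum_distrib_left)
qed

section \<open>Orthonormal bases and quadratic forms in two variables\<close>

lemma cinner_comb: "cinner u (a *s v + b *s w) = a * cinner u v + b * cinner u w"
  by (simp add: cinner_2 algebra_simps)

lemma orthonormal_basis_swap: "orthonormal_basis e0 e1 \<Longrightarrow> cinner e1 e0 = 0"
  using cnj_cinner[of e0 e1] by (simp add: orthonormal_basis_def)

text \<open>Orthonormality makes \<open>dagger U\<close> a left inverse of the matrix
  \<open>U\<close> with columns \<open>e0\<close> and \<open>e1\<close>. For square matrices it is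
  then a right inverse too, and that product is the sum of the two projections.\<close>

lemma orthonormal_basis_complete:
  assumes "orthonormal_basis e0 e1"
  shows "ketbra e0 e0 + ketbra e1 e1 = mat 1"
proof -
  define U :: "complex^2^2" where "U = (\<chi> i j. if j = 1 then e0 $ i else e1 $ i)"
  have "cinner e1 e0 = 0"
    by (rule orthonormal_basis_swap[OF assms])
  then have "dagger U ** U = mat 1"
    using assms
    by (simp add: orthonormal_basis_def cinner_2 U_def dagger_def matrix_matrix_mult_def sum_2
        vec_eq_iff mat_def forall_2)
  then have "U ** dagger U = mat 1"
    using matrix_left_right_inverse by blast
  moreover have "U ** dagger U = ketbra e0 e0 + ketbra e1 e1"
    by (simp add: U_def dagger_def matrix_matrix_mult_def sum_2 ketbra_def vec_eq_iff)
  ultimately show ?thesis by simp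
qed

lemma trace_orthonormal_basis:
  assumes "orthonormal_basis e0 e1"
  shows "trace A = form A e0 e0 + form A e1 e1"
proof -
  have "trace A = trace (A ** (ketbra e0 e0 + ketbra e1 e1))"
    by (simp add: orthonormal_basis_complete[OF assms])
  also have "\<dots> = trace (A ** ketbra e0 e0) + trace (A ** ketbra e1 e1)"
    by (simp add: matrix_add_ldistrib trace_add)
  finally show ?thesis
    by (simp add: trace_mult_ketbra)
qed

lemma conjugate_ketbra: "U ** ketbra u v ** dagger U = ketbra (U *v u) (U *v v)"
  by (simp add: matrix_matrix_mult_def matrix_vector_mult_def ketbra_def dagger_def sum_2
      vec_eq_iff algebra_simps)

text \<open>Determinant criterion for a hermitian form with diagonal \<open>a\<close>,
  \<open>d\<close> and off-diagonal entry \<open>\<beta>\<close>: the cross term is dominated by the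
  one in the square of \<open>sqrt a * cmod v - sqrt d * cmod w\<close>.\<close>

lemma binary_form_nonneg:
  fixes v w \<beta> :: complex and a d :: real
  assumes "a \<ge> 0" "d \<ge> 0" "(cmod \<beta>)\<^sup>2 \<le> a * d"
  shows "0 \<le> a * (cmod v)\<^sup>2 + d * (cmod w)\<^sup>2 + 2 * Re (\<beta> * v * w)"
proof -
  have "cmod \<beta> \<le> sqrt a * sqrt d"
    using assms(3) by (simp add: real_le_rsqrt flip: real_sqrt_mult)
  then have "cmod \<beta> * (cmod v * cmod w) \<le> sqrt a * sqrt d * (cmod v * cmod w)"
    by (intro mult_right_mono) auto
  moreover have "0 \<le> (sqrt a * cmod v - sqrt d * cmod w)\<^sup>2"
    by simp
  moreover have "(sqrt a * cmod v - sqrt d * cmod w)\<^sup>2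
      = a * (cmod v)\<^sup>2 + d * (cmod w)\<^sup>2 - 2 * (sqrt a * sqrt d * (cmod v * cmod w))"
    using assms by (simp add: power2_diff power_mult_distrib)
  moreover have "- Re (\<beta> * v * w) \<le> cmod \<beta> * (cmod v * cmod w)"
    using abs_Re_le_cmod[of "\<beta> * v * w"] by (simp add: norm_mult mult.assoc)
  ultimately show ?thesis by linarith
qed


lemma form_comb:
  "form A (a *s u + b *s v) (c *s u + d *s v)
    = cnj a * c * form A u u + cnj a * d * form A u v
      + cnj b * c * form A v u + cnj b * d * form A v v"
  by (simp add: form_add_left form_add_right form_smult_left form_smult_right algebra_simps)

section \<open>Rotated trine measurements\<close>

text \<open>\<open>w = 1\<close> gives the vectors of \<open>\<M>\<close>, and \<open>w = cis \<theta>\<close> those of \<open>\<N>\<close>; the second vector below is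
  orthogonal to the first for outcomes \<open>2\<close> and \<open>3\<close> only.\<close>

definition trine :: "complex^2 \<Rightarrow> complex^2 \<Rightarrow> complex \<Rightarrow> 3 \<Rightarrow> complex^2" where
  "trine e0 e1 w j =
     (if j = 1 then e0
      else (1/2) *s e0 + ((if j = 2 then 1 else -1) * w * (sqrt 3 / 2)) *s e1)"

definition trine_perp :: "complex^2 \<Rightarrow> complex^2 \<Rightarrow> complex \<Rightarrow> 3 \<Rightarrow> complex^2" where
  "trine_perp e0 e1 w j =
     (sqrt 3 / 2) *s e0 + ((if j = 2 then -1 else 1) * w / 2) *s e1"

lemma meas_M_trine: "meas_M e0 e1 j = (2/3) *\<^sub>R ketbra (trine e0 e1 1 j) (trine e0 e1 1 j)"
proof -
  have "v_plus e0 e1 = (1/2) *s e0 + (sqrt 3 / 2) *s e1"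
    and "v_minus e0 e1 = (1/2) *s e0 + (- sqrt 3 / 2) *s e1"
    by (simp_all add: v_plus_def v_minus_def vec_eq_iff scaleR_conv_of_real[where 'a = complex])
  then show ?thesis
    by (simp add: meas_M_def trine_def)
qed

lemma rot_comb:
  assumes "orthonormal_basis e0 e1"
  shows "rot e0 e1 \<theta> *v (a *s e0 + b *s e1) = a *s e0 + (cis \<theta> * b) *s e1"
proof -
  have ketbra_mult: "ketbra u v *v x = cinner v x *s u" for u v x
    by (simp add: ketbra_def cinner_2 matrix_vector_mult_def sum_2 vec_eq_iff algebra_simps)
  have "cinner e1 e0 = 0"
    by (rule orthonormal_basis_swap[OF assms])
  then show ?thesis
    using assms
    by (simp add: rot_def matrix_vector_mult_add_rdistrib ketbra_mult cinner_comb orthonormal_basis_def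
        vector_smult_assoc mult.commute)
qed

lemma rot_trine:
  assumes "orthonormal_basis e0 e1"
  shows "rot e0 e1 \<theta> *v trine e0 e1 1 j = trine e0 e1 (cis \<theta>) j"
  using rot_comb[OF assms, of \<theta> 1 0] rot_comb[OF assms, of \<theta>]
  by (simp add: trine_def mult.assoc)

lemma meas_N_trine:
  assumes "orthonormal_basis e0 e1"
  shows "meas_N e0 e1 \<theta> j = (2/3) *\<^sub>R ketbra (trine e0 e1 (cis \<theta>) j) (trine e0 e1 (cis \<theta>) j)"
proof -
  have "A ** (r *\<^sub>R B) ** C = r *\<^sub>R (A ** B ** C)" for A B C :: "complex^2^2" and r
    by (simp add: matrix_matrix_mult_def sum_2 vec_eq_iff algebra_simps scaleR_entry
        del: vector_scaleR_component)
  then show ?thesis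
    by (simp add: meas_N_def meas_M_trine conjugate_ketbra rot_trine[OF assms])
qed

section \<open>Lower bound on the failure probability at given \<open>q\<close>\<close>

definition min_failure :: "real \<Rightarrow> real \<Rightarrow> real" where
  "min_failure \<theta> q = (2 * q + sqrt (q\<^sup>2 + 9 * (1 - q)\<^sup>2 + 6 * q * (1 - q) * cos \<theta>)) / 3"

text \<open>The complex number is the matrix element of a diagonal normalization between the vectors
  of the two measurements, for outcomes 2 and 3.\<close>

lemma cmod_trine_sum:
  "cmod (of_real (q / 4) + of_real (3 / 4 * (1 - q)) * cis \<theta>)
    = sqrt (q\<^sup>2 + 9 * (1 - q)\<^sup>2 + 6 * q * (1 - q) * cos \<theta>) / 4"
proof -
  have "(q / 4 + 3 / 4 * (1 - q) * cos \<theta>)\<^sup>2 + (3 / 4 * (1 - q) * sin \<theta>)\<^sup>2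
      = (q\<^sup>2 + 9 * (1 - q)\<^sup>2 + 6 * q * (1 - q) * cos \<theta>) / 4\<^sup>2"
    unfolding power_mult_distrib sin_squared_eq by (simp add: power2_eq_square field_simps)
  then have "sqrt ((q / 4 + 3 / 4 * (1 - q) * cos \<theta>)\<^sup>2 + (3 / 4 * (1 - q) * sin \<theta>)\<^sup>2)
      = sqrt (q\<^sup>2 + 9 * (1 - q)\<^sup>2 + 6 * q * (1 - q) * cos \<theta>) / sqrt (4\<^sup>2)"
    by (simp only: real_sqrt_divide)
  then show ?thesis
    by (simp add: cmod_def)
qed

lemma test_normalization_diagonal:
  assumes basis: "orthonormal_basis e0 e1" and test: "test_with_normalization \<rho> H"
  obtains q where "0 \<le> q" "q \<le> 1" "form \<rho> e0 e0 = of_real q"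
proof -
  have psd: "psd \<rho>" and "trace \<rho> = 1"
    using test by (simp_all add: test_with_normalization_def)
  then have "Re (form \<rho> e0 e0) + Re (form \<rho> e1 e1) = 1"
    by (metis trace_orthonormal_basis[OF basis] one_complex.simps(1) plus_complex.simps(1))
  moreover have "0 \<le> Re (form \<rho> e0 e0)" "0 \<le> Re (form \<rho> e1 e1)"
    using psd by (simp_all add: psd_iff_form)
  ultimately show ?thesis
    using that[of "Re (form \<rho> e0 e0)"] psd_form_real[OF psd, of e0] by simp
qed

lemma failure_prob_ge_min_failure:
  assumes basis: "orthonormal_basis e0 e1" and test: "test_with_normalization \<rho> H"
    and unamb: "unambiguous (meas_M e0 e1) (meas_N e0 e1 \<theta>) H"
    and q: "form \<rho> e0 e0 = of_real q" "0 \<le> q"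
  shows "min_failure \<theta> q \<le> failure_prob (meas_M e0 e1) (meas_N e0 e1 \<theta>) H"
proof -
  define f where "f = (\<lambda>j. cmod (form \<rho> (trine e0 e1 1 j) (trine e0 e1 (cis \<theta>) j)))"
  \<comment> \<open>\<open>z\<close> collects the diagonal entries of \<open>\<rho>\<close> and
    \<open>w\<close> the off-diagonal ones; the sign \<open>\<sigma>\<close> below is 1 for outcome
    2 and -1 for outcome 3.\<close>
  define z where "z = of_real (q / 4) + of_real (3 / 4 * (1 - q)) * cis \<theta>"
  define w where "w = sqrt 3 / 4 * (cis \<theta> * form \<rho> e0 e1 + form \<rho> e1 e0)"
  have "form \<rho> e1 e1 = 1 - of_real q"
    using test trace_orthonormal_basis[OF basis, of \<rho>] q
    by (simp add: test_with_normalization_def algebra_simps)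
  then have *: "form \<rho> ((1/2) *s e0 + (\<sigma> * c) *s e1)
      ((1/2) *s e0 + (\<sigma> * (cis \<theta> * c)) *s e1) = z + \<sigma> * w"
    if "cnj \<sigma> = \<sigma>" "\<sigma> * \<sigma> = 1" "c = of_real (sqrt 3 / 2)" for \<sigma> c
  proof -
    have "c * c = of_real ((sqrt 3 / 2) * (sqrt 3 / 2))"
      unfolding that(3) by (simp only: of_real_mult)
    then have cc: "c * c = 3 / 4" by simp
    have c: "cnj c = c" unfolding that(3) by (rule complex_cnj_complex_of_real)
    have w: "w = c / 2 * (cis \<theta> * form \<rho> e0 e1 + form \<rho> e1 e0)"
      using that(3) by (simp add: w_def)
    have "form \<rho> ((1/2) *s e0 + (\<sigma> * c) *s e1)
          ((1/2) *s e0 + (\<sigma> * (cis \<theta> * c)) *s e1)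
        = of_real q / 4 + (\<sigma> * \<sigma>) * (c * c) * (1 - of_real q) * cis \<theta> + \<sigma> * w"
      using that(1) c unfolding form_comb q(1) \<open>form \<rho> e1 e1 = _\<close> w
      by (simp add: algebra_simps)
    then show ?thesis
      unfolding that(2) cc z_def by simp
  qed
  have "f 2 = cmod (z + w)" "f 3 = cmod (z - w)"
    using *[of 1 "sqrt 3 / 2"] *[of "-1" "sqrt 3 / 2"]
    by (simp_all add: f_def trine_def mult.assoc)
  moreover have "f 1 = q"
    using q by (simp add: f_def trine_def)
  moreover have "2 * cmod z \<le> cmod (z + w) + cmod (z - w)"
    using norm_triangle_ineq[of "z + w" "z - w"] by (simp flip: mult_2 add: norm_mult)
  moreover have "cmod z = sqrt (q\<^sup>2 + 9 * (1 - q)\<^sup>2 + 6 * q * (1 - q) * cos \<theta>) / 4"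
    unfolding z_def by (rule cmod_trine_sum)
  ultimately have "min_failure \<theta> q \<le> 2 / 3 * sum f UNIV"
    by (simp add: min_failure_def sum_3)
  also have "\<dots> \<le> failure_prob (meas_M e0 e1) (meas_N e0 e1 \<theta>) H"
    unfolding f_def
    using meas_M_trine meas_N_trine[OF basis] test unamb by (intro failure_prob_ge_rank_one) auto
  finally show ?thesis .
qed

section \<open>Optimal test at given \<open>q\<close>\<close>

lemma cmod_diff_squared:
  "(cmod (of_real x * a - of_real y * b))\<^sup>2
    = x\<^sup>2 * (cmod a)\<^sup>2 + y\<^sup>2 * (cmod b)\<^sup>2 - 2 * x * y * Re (cnj a * b)"
  unfolding cmod_power2 by (simp add: power2_eq_square algebra_simps)

lemma cmod_cinner_trine_perp:
  assumes "cmod w = 1"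
  shows "(cmod (cinner (trine_perp e0 e1 w j) v))\<^sup>2
    = 3 / 4 * (cmod (cinner e0 v))\<^sup>2 + 1 / 4 * (cmod (cinner e1 v))\<^sup>2
      - (if j = 2 then 1 else -1) * sqrt 3 / 2
        * Re (cnj w * cnj (cinner e0 v) * cinner e1 v)"
proof -
  define \<sigma> :: real where "\<sigma> = (if j = 2 then 1 else -1)"
  have \<sigma>: "\<sigma>\<^sup>2 = 1" by (simp add: \<sigma>_def)
  define a b where "a = cinner e0 v" and "b = cnj w * cinner e1 v"
  have "cinner (trine_perp e0 e1 w j) v = of_real (sqrt 3 / 2) * a - of_real (\<sigma> / 2) * b"
    by (simp add: trine_perp_def cinner_2 a_def b_def \<sigma>_def algebra_simps)
  then have "(cmod (cinner (trine_perp e0 e1 w j) v))\<^sup>2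
      = (sqrt 3 / 2)\<^sup>2 * (cmod a)\<^sup>2 + (\<sigma> / 2)\<^sup>2 * (cmod b)\<^sup>2 - \<sigma> * sqrt 3 / 2 * Re (cnj a * b)"
    by (simp only: cmod_diff_squared) simp
  moreover have "cmod b = cmod (cinner e1 v)"
    using assms by (simp add: b_def norm_mult)
  ultimately show ?thesis
    using \<sigma> by (simp add: a_def b_def \<sigma>_def power_divide mult.assoc mult.left_commute)
qed


lemma cinner_trine:
  assumes "orthonormal_basis e0 e1"
  shows "cinner e0 (trine e0 e1 w j) = (if j = 1 then 1 else 1 / 2)"
    and "cinner e1 (trine e0 e1 w j)
      = (if j = 1 then 0 else (if j = 2 then 1 else -1) * w * of_real (sqrt 3 / 2))"
proof -
  have "cinner e1 e0 = 0"
    by (rule orthonormal_basis_swap[OF assms])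
  then show "cinner e0 (trine e0 e1 w j) = (if j = 1 then 1 else 1 / 2)"
    and "cinner e1 (trine e0 e1 w j)
      = (if j = 1 then 0 else (if j = 2 then 1 else -1) * w * of_real (sqrt 3 / 2))"
    using assms by (simp_all add: trine_def cinner_comb orthonormal_basis_def)
qed

text \<open>For \<open>w = w'\<close> this is zero, which gives unambiguity; for the pair
  \<open>1\<close>, \<open>cis \<theta>\<close> it is the success expectation per unit of weight
  \<open>b\<close>.\<close>

lemma cmod_cinner_trine_perp_trine:
  assumes "orthonormal_basis e0 e1" "cmod w = 1" "cmod w' = 1" "j \<noteq> 1"
  shows "(cmod (cinner (trine_perp e0 e1 w j) (trine e0 e1 w' j)))\<^sup>2
    = 3 / 8 * (1 - Re (cnj w * w'))"
proof -
  have "Re (cnj w * cnj (1 / 2) * (\<sigma> * w' * of_real (sqrt 3 / 2)))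
      = Re \<sigma> * sqrt 3 / 4 * Re (cnj w * w')" if "Im \<sigma> = 0" for \<sigma>
    using that by (simp add: algebra_simps)
  moreover have *: "sqrt 3 * (sqrt 3 * x) = 3 * x" for x :: real
    by (simp flip: mult.assoc)
  ultimately show ?thesis
    using assms
    by (simp add: cmod_cinner_trine_perp cinner_trine[OF assms(1)] norm_mult power_mult_distrib
        power_divide * algebra_simps)
qed

definition diagonal_op :: "complex^2 \<Rightarrow> complex^2 \<Rightarrow> real \<Rightarrow> complex^2^2" where
  "diagonal_op e0 e1 q = q *\<^sub>R ketbra e0 e0 + (1 - q) *\<^sub>R ketbra e1 e1"

text \<open>\<open>First\<close> must annihilate the vector of the second measurement, hence its
  projection uses \<open>cis \<theta>\<close>, and conversely for \<open>Second\<close>. Outcome 1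
  has the same vector in both measurements, so it can never be conclusive with positive
  probability.\<close>

definition optimal_test :: "complex^2 \<Rightarrow> complex^2 \<Rightarrow> real \<Rightarrow> real \<Rightarrow> real \<Rightarrow> test" where
  "optimal_test e0 e1 \<theta> q b c j =
     (let D = \<lambda>w. if j = 1 then 0
                  else b *\<^sub>R ketbra (trine_perp e0 e1 w j) (trine_perp e0 e1 w j)
      in case c of
           First \<Rightarrow> D (cis \<theta>)
         | Second \<Rightarrow> D 1
         | Inconclusive \<Rightarrow> diagonal_op e0 e1 q - D (cis \<theta>) - D 1)"

text \<open>The weight \<open>b\<close> makes the failure operators of outcomes \<open>2\<close> and \<open>3\<close> singular; their expectation
  in \<open>\<psi>\<^sub>j\<close> and in \<open>\<phi>\<^sub>j\<close> then equals \<open>|\<langle>\<psi>\<^sub>j|\<rho>|\<phi>\<^sub>j\<rangle>|\<close>.\<close>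

lemma optimal_weight:
  fixes q \<theta> :: real
  assumes "0 \<le> q" "q \<le> 1"
  obtains b where "0 \<le> b" "3 / 2 * b \<le> q" "b / 2 \<le> 1 - q"
    "(q - 3 / 2 * b) * (1 - q - b / 2) = 3 / 8 * b\<^sup>2 * (1 + cos \<theta>)"
    "b * (3 / 8 * (1 - cos \<theta>)) = (q + 3 * (1 - q)) / 4
       - sqrt (q\<^sup>2 + 9 * (1 - q)\<^sup>2 + 6 * q * (1 - q) * cos \<theta>) / 4"
proof -
  define R where "R = q\<^sup>2 + 9 * (1 - q)\<^sup>2 + 6 * q * (1 - q) * cos \<theta>"
  \<comment> \<open>\<open>s\<close> is the expectation of the normalization in the vectors of
    outcomes 2 and 3, \<open>t\<close> the modulus of its matrix element between them, and
    \<open>D\<close> the overlap of a vector with the projection onto the complement of the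
    other.\<close>
  define s t D where "s = (q + 3 * (1 - q)) / 4" and "t = sqrt R / 4"
    and "D = 3 / 8 * (1 - cos \<theta>)"
  have "R = (q - 3 * (1 - q))\<^sup>2 + 6 * (q * (1 - q) * (1 + cos \<theta>))"
    by (simp add: R_def power2_eq_square algebra_simps)
  moreover have "0 \<le> q * (1 - q) * (1 + cos \<theta>)"
    using assms cos_ge_minus_one[of \<theta>] by (intro mult_nonneg_nonneg) linarith+
  ultimately have R: "(q - 3 * (1 - q))\<^sup>2 \<le> R" by simp
  then have "\<bar>q - 3 * (1 - q)\<bar> \<le> sqrt R"
    by (intro real_le_rsqrt) simp
  then have "q - 3 * (1 - q) \<le> sqrt R" "3 * (1 - q) - q \<le> sqrt R"
    unfolding abs_le_iff by simp_all
  \<comment> \<open>Once \<open>b\<close> is chosen, these two bounds become the nonnegativity of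
    the diagonal entries of the failure operator.\<close>
  then have lower: "3 / 2 * (1 - q) \<le> s + t" "q / 2 \<le> s + t"
    unfolding s_def t_def by (simp_all add: field_simps)
  have pos: "s + t > 0"
    using lower by argo
  have "0 \<le> R" using R zero_le_power2 order_trans by blast
  then have "t\<^sup>2 = R / 16" by (simp add: t_def power_divide)
  then have diff: "(s - t) * (s + t) = D * (q * (1 - q))"
    by (simp add: R_def s_def D_def power2_eq_square field_simps)
  \<comment> \<open>The zero-determinant condition is
    \<open>D * b\<^sup>2 - 2 * s * b + q * (1 - q) = 0\<close>, with smaller root
    \<open>(s - t) / D\<close> when \<open>D\<close> is nonzero. Rewriting it through
    \<open>diff\<close> avoids the division by \<open>D\<close>, which is zero when
    \<open>cos \<theta> = 1\<close>.\<close>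
  define b where "b = q * (1 - q) / (s + t)"
  have b: "b * (s + t) = q * (1 - q)"
    using pos by (simp add: b_def)
  have bD: "b * D = s - t"
    using diff pos by (simp add: b_def field_simps)
  show ?thesis
  proof (rule that)
    show "0 \<le> b" using assms pos by (simp add: b_def)
    show "3 / 2 * b \<le> q"
      using mult_left_mono[OF lower(1) assms(1)] pos by (simp add: b_def field_simps)
    show "b / 2 \<le> 1 - q"
      using mult_left_mono[OF lower(2), of "1 - q"] assms(2) pos by (simp add: b_def field_simps)
    have "(q - 3 / 2 * b) * (1 - q - b / 2) - 3 / 8 * b\<^sup>2 * (1 + cos \<theta>)
        = q * (1 - q) - 2 * b * s + b * (b * D)"
      by (simp add: s_def D_def power2_eq_square field_simps)
    also have "\<dots> = 0"
      unfolding bD using b by (simp add: algebra_simps)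
    finally show "(q - 3 / 2 * b) * (1 - q - b / 2) = 3 / 8 * b\<^sup>2 * (1 + cos \<theta>)"
      by simp
    show "b * (3 / 8 * (1 - cos \<theta>)) = (q + 3 * (1 - q)) / 4
       - sqrt (q\<^sup>2 + 9 * (1 - q)\<^sup>2 + 6 * q * (1 - q) * cos \<theta>) / 4"
      using bD unfolding D_def s_def t_def R_def .
  qed
qed

lemma form_diagonal_op_self:
  "form (diagonal_op e0 e1 q) v v
    = of_real (q * (cmod (cinner e0 v))\<^sup>2 + (1 - q) * (cmod (cinner e1 v))\<^sup>2)"
  by (simp add: diagonal_op_def form_add form_scaleR form_ketbra_self)

lemma psd_diagonal_op: "0 \<le> q \<Longrightarrow> q \<le> 1 \<Longrightarrow> psd (diagonal_op e0 e1 q)"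
  by (simp add: diagonal_op_def psd_add psd_scaleR_ketbra)

lemma psd_optimal_failure:
  assumes b: "3 / 2 * b \<le> q" "b / 2 \<le> 1 - q" "0 \<le> b"
    and det: "(q - 3 / 2 * b) * (1 - q - b / 2) = 3 / 8 * b\<^sup>2 * (1 + cos \<theta>)"
  shows "psd (diagonal_op e0 e1 q
    - b *\<^sub>R ketbra (trine_perp e0 e1 (cis \<theta>) j) (trine_perp e0 e1 (cis \<theta>) j)
    - b *\<^sub>R ketbra (trine_perp e0 e1 1 j) (trine_perp e0 e1 1 j))" (is "psd ?F")
proof -
  have dagger_diff: "dagger (A - B) = dagger A - dagger B" for A B
    by (simp add: dagger_def vec_eq_iff)
  have "psd (diagonal_op e0 e1 q)"
    using b by (intro psd_diagonal_op) linarith+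
  then have "dagger ?F = ?F"
    using psd_scaleR_ketbra[OF b(3)] by (simp add: dagger_diff psd_iff_form)
  moreover have "0 \<le> Re (form ?F v v)" for v
  proof -
    define \<sigma> :: real where "\<sigma> = (if j = 2 then 1 else -1)"
    \<comment> \<open>\<open>\<beta>\<close> is the off-diagonal entry of the failure form in
      \<open>cinner e0 v\<close> and \<open>cinner e1 v\<close>; by \<open>det\<close> the
      determinant is exactly zero.\<close>
    define \<beta> where "\<beta> = of_real (\<sigma> * b * sqrt 3 / 4) * (1 + cnj (cis \<theta>))"
    have "\<sigma>\<^sup>2 = 1" by (simp add: \<sigma>_def)
    moreover have "(cmod (1 + cnj (cis \<theta>)))\<^sup>2 = 2 * (1 + cos \<theta>)"
      unfolding cmod_power2 by (simp add: power2_sum sin_squared_eq)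
    ultimately have "(cmod \<beta>)\<^sup>2 = 3 / 8 * b\<^sup>2 * (1 + cos \<theta>)"
      by (simp add: \<beta>_def norm_mult power_mult_distrib power_divide)
    then have "0 \<le> (q - 3 / 2 * b) * (cmod (cnj (cinner e0 v)))\<^sup>2
        + (1 - q - b / 2) * (cmod (cinner e1 v))\<^sup>2 + 2 * Re (\<beta> * cnj (cinner e0 v) * cinner e1 v)"
      using b det by (intro binary_form_nonneg) auto
    also have "\<dots> = Re (form ?F v v)"
      unfolding form_diff form_scaleR form_ketbra_self form_diagonal_op_self
      by (simp add: cmod_cinner_trine_perp \<beta>_def \<sigma>_def) (simp add: field_simps)
    finally show ?thesis .
  qed
  ultimately show ?thesis
    by (simp add: psd_iff_form)
qed

lemma min_failure_attained:
  assumes basis: "orthonormal_basis e0 e1" and q: "0 \<le> q" "q \<le> 1"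
  obtains H where "test_with_normalization (diagonal_op e0 e1 q) H"
    "unambiguous (meas_M e0 e1) (meas_N e0 e1 \<theta>) H"
    "failure_prob (meas_M e0 e1) (meas_N e0 e1 \<theta>) H = min_failure \<theta> q"
proof -
  obtain b where b: "0 \<le> b" "3 / 2 * b \<le> q" "b / 2 \<le> 1 - q"
    and det: "(q - 3 / 2 * b) * (1 - q - b / 2) = 3 / 8 * b\<^sup>2 * (1 + cos \<theta>)"
    and val: "b * (3 / 8 * (1 - cos \<theta>)) = (q + 3 * (1 - q)) / 4
       - sqrt (q\<^sup>2 + 9 * (1 - q)\<^sup>2 + 6 * q * (1 - q) * cos \<theta>) / 4"
    using optimal_weight[OF q] by metis
  define H where "H = optimal_test e0 e1 \<theta> q b"
  have psd: "psd (H c j)" for c j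
    using psd_optimal_failure[OF b(2,3,1) det] psd_diagonal_op[OF q]
    by (cases c) (simp_all add: H_def optimal_test_def psd_zero psd_scaleR_ketbra b)
  have "trace (diagonal_op e0 e1 q) = 1"
    using basis orthonormal_basis_swap[OF basis]
    by (simp add: trace_orthonormal_basis[OF basis] form_diagonal_op_self orthonormal_basis_def)
  then have test: "test_with_normalization (diagonal_op e0 e1 q) H"
    using psd psd_diagonal_op[OF q]
    by (simp add: test_with_normalization_def) (simp add: H_def optimal_test_def)
  let ?\<psi> = "trine e0 e1 1" and ?\<phi> = "trine e0 e1 (cis \<theta>)"
  note overlap = cmod_cinner_trine_perp_trine[OF basis]
  have unamb: "unambiguous (meas_M e0 e1) (meas_N e0 e1 \<theta>) H"
    unfolding unambiguous_rank_one[OF meas_M_trine meas_N_trine[OF basis] _ psd, simplified]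
    by (simp add: H_def optimal_test_def form_zero form_scaleR form_ketbra_self overlap
        cis_cnj flip: cis_mult)
  \<comment> \<open>Outcome 1 contributes \<open>q\<close> and outcomes 2 and 3 equal amounts, the
    same for both measurements; adding them with weight \<open>2/3\<close> yields
    \<open>min_failure\<close>.\<close>
  have F: "Re (form (H Inconclusive j) v v) = (if j = 1 then q
      else sqrt (q\<^sup>2 + 9 * (1 - q)\<^sup>2 + 6 * q * (1 - q) * cos \<theta>) / 4)"
    if "v = ?\<psi> j \<or> v = ?\<phi> j" for j v
  proof (cases "j = 1")
    case True
    then show ?thesis
      using that
      by (auto simp: H_def optimal_test_def form_diff form_zero form_diagonal_op_self
          cinner_trine[OF basis])
  next
    case False
    have sq: "(cmod (cinner e0 v))\<^sup>2 = 1 / 4" "(cmod (cinner e1 v))\<^sup>2 = 3 / 4"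
      using that False
      by (auto simp: cinner_trine[OF basis] norm_mult power_mult_distrib power_divide)
    have "Re (form (diagonal_op e0 e1 q) v v) = (q + 3 * (1 - q)) / 4"
      unfolding form_diagonal_op_self sq by (simp add: field_simps)
    then have "Re (form (H Inconclusive j) v v) = (q + 3 * (1 - q)) / 4 - b * (3 / 8 * (1 - cos \<theta>))"
      using that False
      by (auto simp: H_def optimal_test_def form_diff form_scaleR form_ketbra_self overlap
          cis_cnj)
    then show ?thesis
      unfolding val using False by simp
  qed
  have "failure_prob (meas_M e0 e1) (meas_N e0 e1 \<theta>) H = min_failure \<theta> q"
    unfolding failure_prob_def concl_prob_rank_one[OF meas_M_trine]
      concl_prob_rank_one[OF meas_N_trine[OF basis]]
    by (simp add: F sum_3 min_failure_def)
  with test unamb show ?thesis using that by blast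
qed

section \<open>Minimization over \<open>q\<close> and comparison with \<open>q = 1/2\<close>\<close>

text \<open>With \<open>v = 1 / (2 + k)\<close>, the second square vanishes exactly at the optimal \<open>q = (1 + v) / 2\<close>.\<close>

lemma radicand_eq:
  fixes k v q :: real
  assumes "(2 + k) * v = 1"
  shows "(4 * q - 3)\<^sup>2 + 4 * k\<^sup>2 * q * (1 - q)
    = (1 + k + v - 2 * q)\<^sup>2 + (12 - 4 * k\<^sup>2) * (q - (1 + v) / 2)\<^sup>2"
  using assms by algebra

text \<open>As \<open>k\<^sup>2 \<le> 3\<close>, dropping the second square of
  \<open>radicand_eq\<close> bounds the root below by \<open>1 + k + v - 2 * q\<close>, so
  \<open>2 * q\<close> cancels. At \<open>q = (1 + v) / 2\<close> nothing is lost, since the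
  remaining base is \<open>k \<ge> 0\<close>.\<close>

lemma min_failure_optimum:
  defines "m \<equiv> \<lambda>\<theta>. 1/3 * (1 + sqrt 3 * \<bar>cos (\<theta>/2)\<bar>
                    + (4 - 2 * sqrt 3 * \<bar>cos (\<theta>/2)\<bar>) / (5 - 3 * cos \<theta>))"
  shows "m \<theta> \<le> min_failure \<theta> q"
    and "\<exists>q. 0 \<le> q \<and> q \<le> 1 \<and> min_failure \<theta> q = m \<theta>"
    and "(\<And>k::int. \<theta> \<noteq> 2 * pi * real_of_int k) \<Longrightarrow> m \<theta> < min_failure \<theta> (1/2)"
proof -
  define k where "k = sqrt 3 * \<bar>cos (\<theta>/2)\<bar>"
  define v where "v = 1 / (2 + k)"
  have k0: "0 \<le> k" by (simp add: k_def)
  then have v: "(2 + k) * v = 1" "0 < v" "v \<le> 1" by (simp_all add: v_def)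
  have k2: "k\<^sup>2 = 3 * (cos (\<theta>/2))\<^sup>2"
    by (simp add: k_def power_mult_distrib)
  then have cos: "cos \<theta> = 2 / 3 * k\<^sup>2 - 1"
    using cos_double_cos[of "\<theta>/2"] by simp
  have k3: "k\<^sup>2 \<le> 3"
    by (simp add: k2 cos_squared_eq)
  then have "k\<^sup>2 < 2\<^sup>2" by simp
  then have "k < 2" by (rule power2_less_imp_less) simp
  moreover have "k * k \<noteq> 4"
    using k3 by (simp add: power2_eq_square)
  \<comment> \<open>The denominator is \<open>2 * (2 - k) * (2 + k)\<close> and the numerator
    \<open>2 * (2 - k)\<close>, nonzero because \<open>k < 2\<close>.\<close>
  ultimately have "(4 - 2 * k) / (5 - 3 * cos \<theta>) = v"
    using k0 unfolding cos v_def
    by (simp add: divide_simps) (simp add: power2_eq_square algebra_simps)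
  moreover have "m \<theta> = 1/3 * (1 + k + (4 - 2 * k) / (5 - 3 * cos \<theta>))"
    by (simp only: m_def k_def mult.assoc)
  ultimately have m: "m \<theta> = (1 + k + v) / 3"
    by simp
  have "q\<^sup>2 + 9 * (1 - q)\<^sup>2 + 6 * q * (1 - q) * cos \<theta> = (4 * q - 3)\<^sup>2 + 4 * k\<^sup>2 * q * (1 - q)" for q
    unfolding cos by (simp add: power2_eq_square algebra_simps)
  then have f: "min_failure \<theta> q
      = (2 * q + sqrt ((1 + k + v - 2 * q)\<^sup>2 + (12 - 4 * k\<^sup>2) * (q - (1 + v) / 2)\<^sup>2)) / 3" for q
    by (simp only: min_failure_def radicand_eq[OF v(1)])
  show "m \<theta> \<le> min_failure \<theta> q"
  proof -
    have "1 + k + v - 2 * q \<le> sqrt ((1 + k + v - 2 * q)\<^sup>2 + (12 - 4 * k\<^sup>2) * (q - (1 + v) / 2)\<^sup>2)"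
      using k3 by (intro real_le_rsqrt) simp
    then show ?thesis unfolding f m by simp
  qed
  show "\<exists>q. 0 \<le> q \<and> q \<le> 1 \<and> min_failure \<theta> q = m \<theta>"
  proof (intro exI conjI)
    show "0 \<le> (1 + v) / 2" "(1 + v) / 2 \<le> 1" using v by simp_all
    show "min_failure \<theta> ((1 + v) / 2) = m \<theta>" using k0 by (simp add: f m)
  qed
  show "m \<theta> < min_failure \<theta> (1/2)" if "\<And>k::int. \<theta> \<noteq> 2 * pi * real_of_int k"
  proof -
    have "sin (\<theta>/2) \<noteq> 0"
      using that by (auto simp: sin_zero_iff_int2 field_simps)
    then have "k\<^sup>2 < 3"
      by (simp add: k2 cos_squared_eq)
    \<comment> \<open>At \<open>q = 1/2\<close> the second square is \<open>(v / 2)\<^sup>2\<close>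
      with \<open>v > 0\<close>, and its coefficient is positive because
      \<open>k\<^sup>2 < 3\<close>.\<close>
    then have "k + v < sqrt ((k + v)\<^sup>2 + (12 - 4 * k\<^sup>2) * (v / 2)\<^sup>2)"
      using v by (intro real_less_rsqrt) simp
    then show ?thesis
      unfolding f m by (simp add: diff_divide_distrib add_divide_distrib power2_eq_square)
  qed
qed

text \<open>Common frame for all three minima: the lower bound sees \<open>\<rho>\<close> only
  through its \<open>e0\<close> diagonal entry \<open>q'\<close>, and a diagonal
  \<open>\<rho>\<close> attains it. Part (i) has \<open>q' = q\<close>, part (ii) takes the optimal
  \<open>q\<close>, and the maximally entangled case forces \<open>q' = 1/2\<close>.\<close>

lemma is_minimum_failure_probs:
  assumes basis: "orthonormal_basis e0 e1" and q: "0 \<le> q" "q \<le> 1"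
    and opt: "P (diagonal_op e0 e1 q)"
    and le: "\<And>\<rho> q'. P \<rho> \<Longrightarrow> form \<rho> e0 e0 = of_real q' \<Longrightarrow> min_failure \<theta> q \<le> min_failure \<theta> q'"
  shows "is_minimum (failure_probs (meas_M e0 e1) (meas_N e0 e1 \<theta>) P) (min_failure \<theta> q)"
proof -
  obtain H where H: "test_with_normalization (diagonal_op e0 e1 q) H"
    "unambiguous (meas_M e0 e1) (meas_N e0 e1 \<theta>) H"
    "failure_prob (meas_M e0 e1) (meas_N e0 e1 \<theta>) H = min_failure \<theta> q"
    using min_failure_attained[OF basis q] .
  then have "min_failure \<theta> q \<in> failure_probs (meas_M e0 e1) (meas_N e0 e1 \<theta>) P"
    using opt unfolding failure_probs_def mem_Collect_eq
    by (intro exI[of _ "diagonal_op e0 e1 q"] exI[of _ H]) simp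
  moreover have "min_failure \<theta> q \<le> failure_prob (meas_M e0 e1) (meas_N e0 e1 \<theta>) H"
    if H: "test_with_normalization \<rho> H" "unambiguous (meas_M e0 e1) (meas_N e0 e1 \<theta>) H" "P \<rho>" for \<rho> H
  proof -
    obtain q' where "0 \<le> q'" "form \<rho> e0 e0 = of_real q'"
      using test_normalization_diagonal[OF basis H(1)] by metis
    then show ?thesis
      using failure_prob_ge_min_failure[OF basis H(1,2)] le[OF H(3)] order_trans by blast
  qed
  ultimately show ?thesis
    unfolding is_minimum_def failure_probs_def by blast
qed

theorem mainTheorem9:
  fixes e0 e1 :: "complex^2" and \<theta> :: real
  assumes "orthonormal_basis e0 e1"
  shows
    "(\<forall>q::real. 0 \<le> q \<and> q \<le> 1 \<longrightarrow>
        is_minimum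
          (failure_probs (meas_M e0 e1) (meas_N e0 e1 \<theta>)
             (\<lambda>\<rho>. cinner e0 (\<rho> *v e0) = complex_of_real q))
          ((2 * q + sqrt (q^2 + 9 * (1 - q)^2 + 6 * q * (1 - q) * cos \<theta>)) / 3))
     \<and> is_minimum
          (failure_probs (meas_M e0 e1) (meas_N e0 e1 \<theta>) (\<lambda>\<rho>. True))
          (1/3 * (1 + sqrt 3 * \<bar>cos (\<theta>/2)\<bar>
                    + (4 - 2 * sqrt 3 * \<bar>cos (\<theta>/2)\<bar>) / (5 - 3 * cos \<theta>)))
     \<and> ((\<forall>k::int. \<theta> \<noteq> 2 * pi * real_of_int k) \<longrightarrow>
          (\<exists>m m_ent.
             is_minimum (failure_probs (meas_M e0 e1) (meas_N e0 e1 \<theta>) (\<lambda>\<rho>. True)) m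
             \<and> is_minimum
                  (failure_probs (meas_M e0 e1) (meas_N e0 e1 \<theta>)
                     (\<lambda>\<rho>. \<rho> = (1/2) *\<^sub>R mat 1)) m_ent
             \<and> m < m_ent))"
proof (intro conjI allI impI)
  let ?S = "failure_probs (meas_M e0 e1) (meas_N e0 e1 \<theta>)"
  let ?m = "1/3 * (1 + sqrt 3 * \<bar>cos (\<theta>/2)\<bar>
                    + (4 - 2 * sqrt 3 * \<bar>cos (\<theta>/2)\<bar>) / (5 - 3 * cos \<theta>))"
  have diag: "form (diagonal_op e0 e1 q) e0 e0 = of_real q" for q
    using assms orthonormal_basis_swap[OF assms] by (simp add: form_diagonal_op_self orthonormal_basis_def)
  show "is_minimum (?S (\<lambda>\<rho>. cinner e0 (\<rho> *v e0) = complex_of_real q))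
          ((2 * q + sqrt (q^2 + 9 * (1 - q)^2 + 6 * q * (1 - q) * cos \<theta>)) / 3)"
    if "0 \<le> q \<and> q \<le> 1" for q
    unfolding min_failure_def[symmetric] form_def[symmetric]
    using that by (intro is_minimum_failure_probs[OF assms]) (simp_all add: diag)
  obtain q where q: "0 \<le> q" "q \<le> 1" "min_failure \<theta> q = ?m"
    using min_failure_optimum(2) by blast
  have "is_minimum (?S (\<lambda>\<rho>. True)) (min_failure \<theta> q)"
    by (rule is_minimum_failure_probs[OF assms q(1,2)])
      (simp_all only: q(3) min_failure_optimum(1))
  then show global: "is_minimum (?S (\<lambda>\<rho>. True)) ?m"
    by (simp only: q(3))
  \<comment> \<open>By completeness of the basis, the maximally entangled normalization is itself
    diagonal, so the same construction attains its minimum.\<close>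
  have half: "diagonal_op e0 e1 (1/2) = (1/2) *\<^sub>R mat 1"
    unfolding orthonormal_basis_complete[OF assms, symmetric]
    by (simp add: diagonal_op_def scaleR_add_right)
  have "is_minimum (?S (\<lambda>\<rho>. \<rho> = (1/2) *\<^sub>R mat 1)) (min_failure \<theta> (1/2))"
  proof (rule is_minimum_failure_probs[OF assms])
    fix \<rho> q'
    assume "\<rho> = (1/2) *\<^sub>R (mat 1 :: complex^2^2)" "form \<rho> e0 e0 = of_real q'"
    then have "of_real q' = complex_of_real (1/2)"
      using diag[of "1/2"] half by simp
    then have q': "q' = 1/2"
      by (simp only: of_real_eq_iff)
    show "min_failure \<theta> (1/2) \<le> min_failure \<theta> q'"
      unfolding q' ..
  qed (simp_all add: half)
  then show "\<exists>m m_ent. is_minimum (?S (\<lambda>\<rho>. True)) m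
      \<and> is_minimum (?S (\<lambda>\<rho>. \<rho> = (1/2) *\<^sub>R mat 1)) m_ent \<and> m < m_ent"
    if "\<forall>k::int. \<theta> \<noteq> 2 * pi * real_of_int k"
    using global min_failure_optimum(3) that by blast
qed

end
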